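(* Let $\Gamma=(V,\rho,a,B)$ be a finite network with edge parameters $R_{xy},L_{xy},D_{xy}$, and assume that $L_{xy}>0$ for all $xy\in E$. Set $$S_D=\sup_{xy\in E}\frac{D_{xy}}{L_{xy}},\qquad S_R=\sup_{xy\in E}\frac{R_{xy}}{L_{xy}},\qquad C'=\sum_{x\sim a}\frac{1}{L_{xa}}.$$ Then, in the domain $$\Omega=\{\lambda\in\mathbb{C}:\operatorname{Im}\lambda\ne0\ \text{and}\ |\lambda|^{2}>S_D\},$$ the function $\mathcal{P}(\lambda)$ is holomorphic and $$|\mathcal{P}(\lambda)|\le\frac{C'\,(2|\lambda|+S_R)^{2}\,|\lambda|^{6}}{(|\lambda|^{2}-S_D)^{3}\,|\operatorname{Im}\lambda|^{3}}.$$
   Context: Let $(V,E)$ be a finite connected undirected graph with $|V|\ge2$, edges being unordered pairs $xy$ of vertices; $x\sim y$ means $xy\in E$. Each edge $xy\in E$ carries real numbers $R_{xy},L_{xy},D_{xy}\in[0,+\infty)$ with $R_{xy}+L_{xy}+D_{xy}>0$. For $\lambda\in\mathbb{C}\setminus\{0\}$ put $z_{xy}^{(\lambda)}=R_{xy}+L_{xy}\lambda+\frac{D_{xy}}{\lambda}$ (impedance) and $\rho_{xy}^{(\lambda)}=1/z_{xy}^{(\lambda)}$ (admittance); set $\rho_{xy}^{(\lambda)}=0$ if $x\not\sim y$. Let $\Lambda$ be the set of those $\lambda\in\mathbb{C}\setminus\{0\}$ with $L_{xy}\lambda^2+R_{xy}\lambda+D_{xy}\ne0$ for all $xy\in E$.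 Fix $a\in V$ and a non-empty $B\subset V$ with $a\notin B$; put $B_0=B\cup\{a\}$. The structure $\Gamma=(V,\rho,a,B)$ is called a finite network. For $\lambda\in\Lambda$ and $f:V\to\mathbb{C}$ put $\Delta_\rho f(x)=\sum_{y\in V}(f(y)-f(x))\rho_{xy}^{(\lambda)}$. The Dirichlet problem for $v:V\to\mathbb{C}$ is: $\Delta_\rho v(x)=0$ for $x\in V\setminus B_0$, $v(x)=0$ for $x\in B$, $v(a)=1$. The effective admittance of $\Gamma$ is $\mathcal{P}(\lambda)=\sum_{x\in V}(1-v(x))\rho_{xa}^{(\lambda)}$ where $v$ is any solution of the Dirichlet problem (the value does not depend on the choice of the solution); if there is no solution, $\mathcal{P}(\lambda)=\infty$. *)

theory Defs
  imports "HOL-Complex_Analysis.Complex_Analysis"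
begin

text \<open>
  The complex frequency \<open>\<lambda>\<close> is written \<open>\<mu>\<close>.

  Edges are unordered pairs \<open>{x, y}\<close>, and the edge parameters are functions of the unordered
  pair, so they are symmetric by construction.  Loops are the singletons \<open>{x, x} = {x}\<close>; they
  are not excluded.
\<close>

locale finite_network =
  fixes V :: "'v set" and E :: "'v set set"
    and R L D :: "'v set \<Rightarrow> real"
    and a :: 'v and B :: "'v set"
  assumes finite_V: "finite V"
    and card_V: "card V \<ge> 2"
    and edges: "E \<subseteq> {{x, y} | x y. x \<in> V \<and> y \<in> V}"
    and connected_graph: "\<And>x y. x \<in> V \<Longrightarrow> y \<in> V \<Longrightarrow> (x, y) \<in> {(u, w). {u, w} \<in> E}\<^sup>*"
    and R_nonneg: "\<And>e. e \<in> E \<Longrightarrow> R e \<ge> 0"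
    and L_nonneg: "\<And>e. e \<in> E \<Longrightarrow> L e \<ge> 0"
    and D_nonneg: "\<And>e. e \<in> E \<Longrightarrow> D e \<ge> 0"
    and RLD_pos: "\<And>e. e \<in> E \<Longrightarrow> R e + L e + D e > 0"
    and a_in_V: "a \<in> V"
    and B_subset_V: "B \<subseteq> V"
    and B_nonempty: "B \<noteq> {}"
    and a_notin_B: "a \<notin> B"

definition impedance ::
    "('v set \<Rightarrow> real) \<Rightarrow> ('v set \<Rightarrow> real) \<Rightarrow> ('v set \<Rightarrow> real) \<Rightarrow> complex \<Rightarrow> 'v set \<Rightarrow> complex"
  where "impedance R L D \<mu> e =
    complex_of_real (R e) + complex_of_real (L e) * \<mu> + complex_of_real (D e) / \<mu>"

definition admittance ::
    "'v set set \<Rightarrow> ('v set \<Rightarrow> real) \<Rightarrow> ('v set \<Rightarrow> real) \<Rightarrow> ('v set \<Rightarrow> real) \<Rightarrow> complex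
      \<Rightarrow> 'v \<Rightarrow> 'v \<Rightarrow> complex"
  where "admittance E R L D \<mu> x y =
    (if {x, y} \<in> E then 1 / impedance R L D \<mu> {x, y} else 0)"

definition admissible ::
    "'v set set \<Rightarrow> ('v set \<Rightarrow> real) \<Rightarrow> ('v set \<Rightarrow> real) \<Rightarrow> ('v set \<Rightarrow> real) \<Rightarrow> complex set"
  where "admissible E R L D =
    {\<mu>. \<mu> \<noteq> 0 \<and> (\<forall>e\<in>E. complex_of_real (L e) * \<mu>\<^sup>2 + complex_of_real (R e) * \<mu>
        + complex_of_real (D e) \<noteq> 0)}"

definition laplacian ::
    "'v set \<Rightarrow> ('v \<Rightarrow> 'v \<Rightarrow> complex) \<Rightarrow> ('v \<Rightarrow> complex) \<Rightarrow> 'v \<Rightarrow> complex"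
  where "laplacian V \<rho> f x = (\<Sum>y\<in>V. (f y - f x) * \<rho> x y)"

text \<open>Only the values of a solution on \<open>V\<close> matter.\<close>

definition dirichlet_solution ::
    "'v set \<Rightarrow> ('v \<Rightarrow> 'v \<Rightarrow> complex) \<Rightarrow> 'v \<Rightarrow> 'v set \<Rightarrow> ('v \<Rightarrow> complex) \<Rightarrow> bool"
  where "dirichlet_solution V \<rho> a B v \<longleftrightarrow>
    (\<forall>x\<in>V - (B \<union> {a}). laplacian V \<rho> v x = 0) \<and> (\<forall>x\<in>B. v x = 0) \<and> v a = 1"

text \<open>
  The value \<open>None\<close> stands for \<open>\<infinity>\<close>.  The choice of the solution is immaterial, see
  \<open>effective_admittance_eq\<close> below.  The definition is meant for \<open>\<mu>\<close> in \<open>admissible E R L D\<close>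
  only.
\<close>

definition effective_admittance ::
    "'v set \<Rightarrow> 'v set set \<Rightarrow> ('v set \<Rightarrow> real) \<Rightarrow> ('v set \<Rightarrow> real) \<Rightarrow> ('v set \<Rightarrow> real)
      \<Rightarrow> 'v \<Rightarrow> 'v set \<Rightarrow> complex \<Rightarrow> complex option"
  where "effective_admittance V E R L D a B \<mu> =
    (let \<rho> = admittance E R L D \<mu> in
     if \<exists>v. dirichlet_solution V \<rho> a B v
     then Some (\<Sum>x\<in>V. (1 - (SOME v. dirichlet_solution V \<rho> a B v) x) * \<rho> x a)
     else None)"

lemma admittance_sym: "admittance E R L D \<mu> x y = admittance E R L D \<mu> y x"
  by (simp add: admittance_def insert_commute)

lemma laplacian_green:
  assumes sym: "\<And>x y. \<rho> x y = \<rho> y x"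
  shows "(\<Sum>x\<in>V. laplacian V \<rho> f x * g x) = (\<Sum>x\<in>V. laplacian V \<rho> g x * f x)"
proof -
  have *: "(\<Sum>x\<in>V. laplacian V \<rho> f x * g x) =
      (\<Sum>x\<in>V. \<Sum>y\<in>V. f y * g x * \<rho> x y) - (\<Sum>x\<in>V. \<Sum>y\<in>V. f x * g x * \<rho> x y)"
    for f g :: "'a \<Rightarrow> complex"
    unfolding laplacian_def sum_distrib_right sum_subtractf[symmetric]
    by (intro sum.cong refl) (simp add: algebra_simps)
  have "(\<Sum>x\<in>V. \<Sum>y\<in>V. f y * g x * \<rho> x y) = (\<Sum>y\<in>V. \<Sum>x\<in>V. f y * g x * \<rho> x y)"
    by (rule sum.swap)
  also have "\<dots> = (\<Sum>x\<in>V. \<Sum>y\<in>V. g y * f x * \<rho> x y)"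
    by (intro sum.cong refl) (subst sym, simp)
  finally show ?thesis
    unfolding * by (simp add: mult.commute)
qed

context finite_network
begin

lemma effective_admittance_eq:
  assumes v: "dirichlet_solution V (admittance E R L D \<mu>) a B v"
  shows "effective_admittance V E R L D a B \<mu> =
    Some (\<Sum>x\<in>V. (1 - v x) * admittance E R L D \<mu> x a)"
proof -
  define \<rho> where "\<rho> = admittance E R L D \<mu>"
  have sym: "\<rho> x y = \<rho> y x" for x y
    unfolding \<rho>_def by (rule admittance_sym)
  define u where "u = (SOME u. dirichlet_solution V \<rho> a B u)"
  have v': "dirichlet_solution V \<rho> a B v"
    using v by (simp add: \<rho>_def)
  then have u': "dirichlet_solution V \<rho> a B u"
    unfolding u_def by (rule someI[where P = "dirichlet_solution V \<rho> a B"])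
  have at_a: "(\<Sum>x\<in>V. laplacian V \<rho> f x * g x) = laplacian V \<rho> f a"
    if "dirichlet_solution V \<rho> a B f" "dirichlet_solution V \<rho> a B g" for f g
  proof -
    have "(\<Sum>x\<in>V. laplacian V \<rho> f x * g x) = (\<Sum>x\<in>{a}. laplacian V \<rho> f x * g x)"
      by (rule sum.mono_neutral_right)
        (use that finite_V a_in_V in \<open>auto simp: dirichlet_solution_def\<close>)
    then show ?thesis
      using that by (simp add: dirichlet_solution_def)
  qed
  have current: "(\<Sum>x\<in>V. (1 - f x) * \<rho> x a) = - laplacian V \<rho> f a"
    if "dirichlet_solution V \<rho> a B f" for f
  proof -
    have "f a = 1"
      using that by (simp add: dirichlet_solution_def)
    then show ?thesis
      by (simp add: laplacian_def sym[of a] left_diff_distrib sum_subtractf)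
  qed
  have "laplacian V \<rho> u a = laplacian V \<rho> v a"
    using at_a[OF u' v'] at_a[OF v' u'] laplacian_green[where \<rho> = \<rho> and f = u and g = v, OF sym]
    by simp
  then have "(\<Sum>x\<in>V. (1 - u x) * \<rho> x a) = (\<Sum>x\<in>V. (1 - v x) * \<rho> x a)"
    by (simp add: current u' v')
  then show ?thesis
    using v' unfolding effective_admittance_def Let_def \<rho>_def[symmetric] u_def[symmetric] by auto
qed

end

end

theory Submission
  imports Defs
begin

text \<open>
  With \<open>L > 0\<close> on every edge and \<open>S\<close> the largest ratio \<open>D / L\<close>, the imaginary part
  \<open>Im \<mu> * (L - D / \<bar>\<mu>\<bar>\<^sup>2)\<close> of the impedance has the sign of \<open>Im \<mu>\<close> on every edge as soon as
  \<open>\<bar>\<mu>\<bar>\<^sup>2 > S\<close>.  Hence all admittances \<open>\<rho>\<close> lie in one and the same open half-plane, and the imaginary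
  part of the Dirichlet form \<open>q(f, g) = 1/2 \<Sum> (f x - f y) (g x - g y) \<rho> x y\<close> at \<open>g = cnj f\<close> is, up
  to a common sign, a positive quadratic form in the differences of \<open>f\<close> along edges, here called the
  dissipation.  Everything follows from this coercivity, by way of the Green identity
  \<open>q(v, g) = P * g a\<close>, valid for the solution \<open>v\<close> of the Dirichlet problem, its effective
  admittance \<open>P\<close> and every \<open>g\<close> that vanishes on \<open>B\<close> (\<open>admittance_eq_dirichlet_form\<close>).

  Solvability: a function that vanishes on \<open>B \<union> {a}\<close> and is harmonic elsewhere has no dissipation, so
  it is constant on the connected graph and thus zero.  If only the condition at \<open>a\<close> is dropped,
  there is one more unknown than equations, so a nonzero solution exists; by uniqueness it does not
  vanish at \<open>a\<close> and can be normalised there.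

  Bound: the choice \<open>g = cnj v\<close> shows that the dissipation of \<open>v\<close> is at most \<open>\<bar>P\<bar>\<close>.  As
  \<open>P = \<Sum> (1 - v x) \<rho> x a\<close>, the weighted inequality \<open>t r \<le> (t\<^sup>2 \<sigma> + r\<^sup>2 / \<sigma>) / 2\<close>
  with \<open>\<sigma> = \<bar>Im \<rho> x a\<bar>\<close> gives \<open>\<bar>P\<bar> \<le> (\<bar>P\<bar> + K) / 2\<close>, where
  \<open>K = \<Sum> \<bar>\<rho> x a\<bar>\<^sup>2 / \<bar>Im \<rho> x a\<bar> = \<Sum> 1 / \<bar>Im z x a\<bar>\<close> runs over the edges at \<open>a\<close>; so \<open>\<bar>P\<bar> \<le> K\<close>.
  The lower bound for \<open>\<bar>Im z\<bar>\<close> then yields \<open>\<bar>P\<bar> \<le> C' \<bar>\<mu>\<bar>\<^sup>2 / (\<bar>Im \<mu>\<bar> (\<bar>\<mu>\<bar>\<^sup>2 - S))\<close>, which is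
  stronger than the claim because \<open>\<bar>\<mu>\<bar>\<^sup>2 - S \<le> \<bar>\<mu>\<bar>\<^sup>2\<close> and \<open>\<bar>Im \<mu>\<bar> \<le> \<bar>\<mu>\<bar>\<close>.

  Holomorphy: testing the Green identity at two frequencies with each other's solutions gives
  \<open>P(\<nu>) - P(\<mu>) = 1/2 \<Sum> (v\<^sub>\<nu> x - v\<^sub>\<nu> y) (v\<^sub>\<mu> x - v\<^sub>\<mu> y) (\<rho>\<^sub>\<nu> x y - \<rho>\<^sub>\<mu> x y)\<close>
  (\<open>admittance_difference\<close>).  Coercivity also shows that the differences of \<open>v\<^sub>\<nu>\<close> along edges tend
  to those of \<open>v\<^sub>\<mu>\<close> (\<open>dissipation_perturbation\<close>), so the difference quotient converges, to the
  Dirichlet form of \<open>v\<^sub>\<mu>\<close> with weights \<open>d\<rho> / d\<mu>\<close>; no formula for \<open>v\<close> is involved.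
\<close>

section \<open>The Dirichlet form\<close>

text \<open>
  Bilinear rather than sesquilinear, so that it is symmetric even for complex weights; the comparison
  of two frequencies relies on this symmetry.
\<close>

definition dirichlet_form ::
    "'v set \<Rightarrow> ('v \<Rightarrow> 'v \<Rightarrow> complex) \<Rightarrow> ('v \<Rightarrow> complex) \<Rightarrow> ('v \<Rightarrow> complex) \<Rightarrow> complex"
  where "dirichlet_form V \<rho> f g = (\<Sum>x\<in>V. \<Sum>y\<in>V. (f x - f y) * (g x - g y) * \<rho> x y) / 2"

definition dissipation :: "'v set \<Rightarrow> ('v \<Rightarrow> 'v \<Rightarrow> complex) \<Rightarrow> ('v \<Rightarrow> complex) \<Rightarrow> real"
  where "dissipation V \<rho> f = (\<Sum>x\<in>V. \<Sum>y\<in>V. (cmod (f x - f y))\<^sup>2 * \<bar>Im (\<rho> x y)\<bar>) / 2"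

lemma dirichlet_form_commute: "dirichlet_form V \<rho> f g = dirichlet_form V \<rho> g f"
  by (simp add: dirichlet_form_def mult.commute)

lemma dirichlet_form_diff_left:
  "dirichlet_form V \<rho> (\<lambda>x. f x - g x) h = dirichlet_form V \<rho> f h - dirichlet_form V \<rho> g h"
  by (simp add: dirichlet_form_def diff_divide_distrib[symmetric] sum_subtractf[symmetric]
      algebra_simps)

lemma dirichlet_form_diff_weight:
  "dirichlet_form V (\<lambda>x y. \<rho> x y - \<rho>' x y) f g = dirichlet_form V \<rho> f g - dirichlet_form V \<rho>' f g"
  by (simp add: dirichlet_form_def diff_divide_distrib[symmetric] sum_subtractf[symmetric]
      right_diff_distrib)

text \<open>Summation by parts: exchanging \<open>x\<close> and \<open>y\<close> and averaging turns \<open>g x\<close> into \<open>(g x - g y) / 2\<close>.\<close>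

lemma laplacian_eq_dirichlet_form:
  assumes sym: "\<And>x y. \<rho> x y = \<rho> y x"
  shows "(\<Sum>x\<in>V. laplacian V \<rho> f x * g x) = - dirichlet_form V \<rho> f g"
proof -
  define S where "S = (\<Sum>x\<in>V. \<Sum>y\<in>V. (f y - f x) * \<rho> x y * g x)"
  have "S = (\<Sum>y\<in>V. \<Sum>x\<in>V. (f y - f x) * \<rho> x y * g x)"
    unfolding S_def by (rule sum.swap)
  also have "\<dots> = (\<Sum>x\<in>V. \<Sum>y\<in>V. (f x - f y) * \<rho> x y * g y)"
    by (intro sum.cong refl) (subst sym, simp)
  finally have "S + S = (\<Sum>x\<in>V. \<Sum>y\<in>V. (f y - f x) * \<rho> x y * g x + (f x - f y) * \<rho> x y * g y)"
    by (subst (asm) S_def, simp add: S_def sum.distrib)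
  also have "\<dots> = (\<Sum>x\<in>V. \<Sum>y\<in>V. - ((f x - f y) * (g x - g y) * \<rho> x y))"
    by (intro sum.cong refl) (simp add: algebra_simps)
  also have "\<dots> = - 2 * dirichlet_form V \<rho> f g"
    by (simp add: dirichlet_form_def sum_negf)
  finally have "S = - dirichlet_form V \<rho> f g"
    by simp
  then show ?thesis
    by (simp add: S_def laplacian_def sum_distrib_right)
qed

text \<open>
  Coercivity: since the weights have imaginary parts of a common sign \<open>s\<close>, no cancellation takes
  place in the imaginary part of the form at \<open>f\<close> and \<open>cnj f\<close>.
\<close>

lemma dissipation_le_form:
  assumes s: "\<bar>s\<bar> = 1" and sgn: "\<And>x y. \<bar>Im (\<rho> x y)\<bar> = s * Im (\<rho> x y)"
  shows "dissipation V \<rho> f \<le> cmod (dirichlet_form V \<rho> f (\<lambda>x. cnj (f x)))"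
proof -
  have *: "(f x - f y) * (cnj (f x) - cnj (f y)) = complex_of_real ((cmod (f x - f y))\<^sup>2)" for x y
    by (metis complex_cnj_diff complex_norm_square)
  have "dissipation V \<rho> f = s * Im (dirichlet_form V \<rho> f (\<lambda>x. cnj (f x)))"
    unfolding dissipation_def dirichlet_form_def * sgn
    by (simp add: sum_distrib_left sum_divide_distrib mult_ac del: of_real_power)
  also have "\<dots> \<le> \<bar>s\<bar> * \<bar>Im (dirichlet_form V \<rho> f (\<lambda>x. cnj (f x)))\<bar>"
    by (metis abs_ge_self abs_mult)
  also have "\<dots> \<le> cmod (dirichlet_form V \<rho> f (\<lambda>x. cnj (f x)))"
    using s abs_Im_le_cmod by simp
  finally show ?thesis .
qed

lemma weighted_am_gm:
  fixes t r \<sigma> :: real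
  assumes "\<sigma> > 0"
  shows "t * r \<le> (t\<^sup>2 * \<sigma> + r\<^sup>2 / \<sigma>) / 2"
proof -
  have "0 \<le> (t * \<sigma> - r)\<^sup>2 / \<sigma>"
    using assms by simp
  also have "(t * \<sigma> - r)\<^sup>2 / \<sigma> = t\<^sup>2 * \<sigma> - 2 * (t * r) + r\<^sup>2 / \<sigma>"
    using assms by (simp add: power2_eq_square field_simps)
  finally show ?thesis by simp
qed

section \<open>Underdetermined homogeneous systems\<close>

text \<open>
  Gaussian elimination over index sets: an equation with a nonzero coefficient at \<open>k\<close> is used to
  eliminate the unknown \<open>k\<close> from the others, which lowers both counts by one.
\<close>

lemma underdetermined_system_nontrivial_solution:
  fixes A :: "'i \<Rightarrow> 'j \<Rightarrow> 'a::field"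
  assumes "finite I" "finite J" "card I < card J"
  shows "\<exists>c. (\<exists>j\<in>J. c j \<noteq> 0) \<and> (\<forall>i\<in>I. (\<Sum>j\<in>J. A i j * c j) = 0)"
  using assms
proof (induction I arbitrary: A J rule: finite_induct)
  case empty
  then have "J \<noteq> {}" by auto
  then show ?case by (intro exI[of _ "\<lambda>_. 1"]) auto
next
  case (insert i I)
  show ?case
  proof (cases "\<forall>j\<in>J. A i j = 0")
    case True
    have "card I < card J"
      using insert by simp
    from insert.IH[OF insert.prems(1) this] True show ?thesis by auto
  next
    case False
    then obtain k where k: "k \<in> J" "A i k \<noteq> 0" by auto
    define J' where "J' = J - {k}"
    have J': "finite J'" "card I < card J'" and J: "J = insert k J'" "k \<notin> J'"
      using insert k by (auto simp: J'_def)
    obtain c where c: "\<exists>j\<in>J'. c j \<noteq> 0"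
      "\<And>l. l \<in> I \<Longrightarrow> (\<Sum>j\<in>J'. (A l j - A l k * A i j / A i k) * c j) = 0"
      using insert.IH[OF J', of "\<lambda>l j. A l j - A l k * A i j / A i k"] by blast
    define S where "S l = (\<Sum>j\<in>J'. A l j * c j)" for l
    define c' where "c' = c(k := - S i / A i k)"
    have c': "(\<Sum>j\<in>J. A l j * c' j) = A l k * (- S i / A i k) + S l" for l
    proof -
      have "(\<Sum>j\<in>J'. A l j * c' j) = S l"
        unfolding S_def by (rule sum.cong) (use J in \<open>auto simp: c'_def\<close>)
      then show ?thesis
        using J J' by (simp add: c'_def)
    qed
    have "A l k * (- S i / A i k) + S l = 0" if "l \<in> I" for l
    proof -
      have "(A l j - A l k * A i j / A i k) * c j = A l j * c j - A l k / A i k * (A i j * c j)" for j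
        by (simp add: left_diff_distrib)
      then have "S l - A l k / A i k * S i = 0"
        using c(2)[OF that] unfolding S_def by (simp only: sum_subtractf sum_distrib_left)
      then show ?thesis by simp
    qed
    then have "(\<Sum>j\<in>J. A l j * c' j) = 0" if "l \<in> I" for l
      unfolding c' using that by blast
    moreover have "(\<Sum>j\<in>J. A i j * c' j) = 0"
      unfolding c' using k by simp
    ultimately have "\<forall>l\<in>insert i I. (\<Sum>j\<in>J. A l j * c' j) = 0"
      by blast
    moreover have "\<exists>j\<in>J. c' j \<noteq> 0"
      using c(1) J by (auto simp: c'_def)
    ultimately show ?thesis by blast
  qed
qed

section \<open>Networks with admittances in a half-plane\<close>

text \<open>
  The admittances at a single frequency, with the impedances abstracted away: all that matters is
  that the admittances of edges lie in the same one of the two open half-planes bounded by the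
  real axis, the lower one for \<open>s = -1\<close>.
\<close>

locale dissipative_network = finite_network V E R L D a B
  for V :: "'v set" and E :: "'v set set" and R L D :: "'v set \<Rightarrow> real"
    and a :: 'v and B :: "'v set" +
  fixes \<rho> :: "'v \<Rightarrow> 'v \<Rightarrow> complex" and s :: real
  assumes sym: "\<rho> x y = \<rho> y x"
    and off_edge: "{x, y} \<notin> E \<Longrightarrow> \<rho> x y = 0"
    and abs_s: "\<bar>s\<bar> = 1"
    and one_signed: "\<bar>Im (\<rho> x y)\<bar> = s * Im (\<rho> x y)"
    and strict: "{x, y} \<in> E \<Longrightarrow> Im (\<rho> x y) \<noteq> 0"
begin

lemma edge_in_V: "{x, y} \<in> E \<Longrightarrow> x \<in> V \<and> y \<in> V"
  using edges by (fastforce simp: doubleton_eq_iff)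

lemma dissipation_edge:
  assumes "x \<in> V" "y \<in> V"
  shows "(cmod (u x - u y))\<^sup>2 * \<bar>Im (\<rho> x y)\<bar> \<le> 2 * dissipation V \<rho> u"
proof -
  have "(cmod (u x - u y))\<^sup>2 * \<bar>Im (\<rho> x y)\<bar> \<le> (\<Sum>y\<in>V. (cmod (u x - u y))\<^sup>2 * \<bar>Im (\<rho> x y)\<bar>)"
    by (rule member_le_sum[of y V "\<lambda>y. (cmod (u x - u y))\<^sup>2 * \<bar>Im (\<rho> x y)\<bar>"])
      (use assms finite_V in auto)
  also have "\<dots> \<le> (\<Sum>x\<in>V. \<Sum>y\<in>V. (cmod (u x - u y))\<^sup>2 * \<bar>Im (\<rho> x y)\<bar>)"
    by (rule member_le_sum[of x V "\<lambda>x. \<Sum>y\<in>V. (cmod (u x - u y))\<^sup>2 * \<bar>Im (\<rho> x y)\<bar>"])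
      (use assms finite_V in \<open>auto intro: sum_nonneg\<close>)
  finally show ?thesis by (simp add: dissipation_def)
qed

text \<open>
  In the dissipation each pair \<open>{x, c}\<close> is counted twice, once in each order, which makes up for the
  factor \<open>1/2\<close>.
\<close>

lemma dissipation_at_vertex:
  assumes "c \<in> V"
  shows "(\<Sum>x\<in>V. (cmod (u x - u c))\<^sup>2 * \<bar>Im (\<rho> x c)\<bar>) \<le> dissipation V \<rho> u"
proof -
  define T where "T x y = (cmod (u x - u y))\<^sup>2 * \<bar>Im (\<rho> x y)\<bar>" for x y
  have T: "T x y \<ge> 0" "T x x = 0" for x y
    by (simp_all add: T_def)
  have T_sym: "T x y = T y x" for x y
    unfolding T_def by (subst sym, subst norm_minus_commute, rule refl)
  define V' where "V' = V - {c}"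
  have V: "V = insert c V'" "c \<notin> V'" "finite V'"
    using assms finite_V by (auto simp: V'_def)
  have row: "(\<Sum>y\<in>V. T x y) \<ge> T x c" for x
    using V T(1)[of x] by (simp add: sum_nonneg)
  have "(\<Sum>x\<in>V. T x c) = (\<Sum>x\<in>V'. T x c)"
    using V T(2)[of c] by simp
  moreover have "(\<Sum>x\<in>V. T x c) = (\<Sum>y\<in>V. T c y)"
    by (rule sum.cong[OF refl T_sym])
  ultimately have "2 * (\<Sum>x\<in>V. T x c) = (\<Sum>y\<in>V. T c y) + (\<Sum>x\<in>V'. T x c)"
    by linarith
  also have "\<dots> \<le> (\<Sum>y\<in>V. T c y) + (\<Sum>x\<in>V'. \<Sum>y\<in>V. T x y)"
    by (intro add_mono sum_mono row order_refl)
  also have "\<dots> = (\<Sum>x\<in>V. \<Sum>y\<in>V. T x y)"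
    using V by simp
  finally show ?thesis
    by (simp add: dissipation_def T_def)
qed

lemma dirichlet_form_harmonic:
  assumes f: "\<And>x. x \<in> V - (B \<union> {a}) \<Longrightarrow> laplacian V \<rho> f x = 0" and g: "\<And>x. x \<in> B \<Longrightarrow> g x = 0"
  shows "dirichlet_form V \<rho> f g = - laplacian V \<rho> f a * g a"
proof -
  have "(\<Sum>x\<in>V. laplacian V \<rho> f x * g x) = (\<Sum>x\<in>{a}. laplacian V \<rho> f x * g x)"
    by (rule sum.mono_neutral_right) (use assms finite_V a_in_V in auto)
  also have "\<dots> = laplacian V \<rho> f a * g a"
    by simp
  finally have "laplacian V \<rho> f a * g a = - dirichlet_form V \<rho> f g"
    using laplacian_eq_dirichlet_form[where \<rho> = \<rho> and f = f and g = g and V = V, OF sym] by simp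
  then show ?thesis
    by simp
qed

lemma constant_if_edgewise_constant:
  assumes "\<And>x y. {x, y} \<in> E \<Longrightarrow> u x = u y" "x \<in> V" "y \<in> V"
  shows "u x = u y"
proof -
  have "(x, y) \<in> {(u, w). {u, w} \<in> E}\<^sup>*"
    using connected_graph assms by blast
  then show ?thesis
    by (induction rule: rtrancl_induct) (use assms(1) in auto)
qed

text \<open>
  Here \<open>q(u, cnj u) = 0\<close> by the Green identity, hence no dissipation, hence equal values at the ends of every
  edge; connectedness spreads the value \<open>0\<close> from \<open>a\<close>.
\<close>

lemma dirichlet_zero_unique:
  assumes harm: "\<And>x. x \<in> V - (B \<union> {a}) \<Longrightarrow> laplacian V \<rho> u x = 0"
    and B: "\<And>x. x \<in> B \<Longrightarrow> u x = 0" and a: "u a = 0" and x: "x \<in> V"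
  shows "u x = 0"
proof -
  have "dirichlet_form V \<rho> u (\<lambda>x. cnj (u x)) = 0"
    using dirichlet_form_harmonic[OF harm, where g = "\<lambda>x. cnj (u x)"] B a by simp
  then have diss: "dissipation V \<rho> u \<le> 0"
    using dissipation_le_form[of s \<rho> V u] abs_s one_signed by simp
  have "u x = u y" if "{x, y} \<in> E" for x y
  proof -
    have "(cmod (u x - u y))\<^sup>2 * \<bar>Im (\<rho> x y)\<bar> \<le> 0"
      using dissipation_edge[of x y u] edge_in_V[OF that] diss by simp
    then show ?thesis
      using strict[OF that] by (simp add: mult_le_0_iff)
  qed
  then have "u x = u a"
    using constant_if_edgewise_constant a_in_V x by blast
  then show ?thesis using a by simp
qed

text \<open>
  Without the condition at \<open>a\<close> there is one equation for each interior vertex, and one more unknown,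
  the value at \<open>a\<close>.  A nonzero solution cannot vanish at \<open>a\<close> by uniqueness, so dividing by its
  value there solves the problem.
\<close>

lemma dirichlet_solution_exists: "\<exists>v. dirichlet_solution V \<rho> a B v"
proof -
  define I where "I = V - (B \<union> {a})"
  have I: "finite I" "a \<notin> I" and V: "V = insert a I \<union> B" "insert a I \<inter> B = {}"
    using finite_V a_in_V B_subset_V a_notin_B by (auto simp: I_def)
  have fB: "finite B"
    using B_subset_V finite_V finite_subset by blast
  \<comment> \<open>The matrix of the Laplacian: \<open>laplacian V \<rho> f x\<close> is the sum of \<open>A x y * f y\<close> over \<open>y\<close>, for \<open>x\<close> in \<open>V\<close>.\<close>
  define A where "A x y = \<rho> x y - (if y = x then \<Sum>z\<in>V. \<rho> x z else 0)" for x y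
  obtain c where c: "\<exists>y\<in>insert a I. c y \<noteq> 0" "\<And>x. x \<in> I \<Longrightarrow> (\<Sum>y\<in>insert a I. A x y * c y) = 0"
    using underdetermined_system_nontrivial_solution[of I "insert a I" A] I by auto
  define f where "f x = (if x \<in> B then 0 else c x)" for x
  have f: "laplacian V \<rho> f x = 0" if "x \<in> I" for x
  proof -
    have "0 = (\<Sum>y\<in>insert a I. A x y * f y)"
      unfolding c(2)[OF that, symmetric] by (intro sum.cong refl) (use V in \<open>auto simp: f_def\<close>)
    also have "\<dots> = (\<Sum>y\<in>V. A x y * f y)"
      by (rule sum.mono_neutral_left) (use V finite_V in \<open>auto simp: f_def\<close>)
    also have "\<dots> = (\<Sum>y\<in>V. \<rho> x y * f y) - (\<Sum>y\<in>V. if y = x then (\<Sum>z\<in>V. \<rho> x z) * f x else 0)"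
      unfolding sum_subtractf[symmetric]
      by (intro sum.cong refl) (auto simp: A_def algebra_simps)
    also have "\<dots> = (\<Sum>y\<in>V. f y * \<rho> x y) - (\<Sum>y\<in>V. f x * \<rho> x y)"
      using that finite_V by (simp add: I_def sum_distrib_left mult.commute)
    also have "\<dots> = laplacian V \<rho> f x"
      by (simp add: laplacian_def left_diff_distrib sum_subtractf)
    finally show ?thesis by simp
  qed
  have "f a \<noteq> 0"
  proof
    assume "f a = 0"
    then have "f x = 0" if "x \<in> V" for x
      by (intro dirichlet_zero_unique[of f x]) (use f that in \<open>auto simp: I_def f_def\<close>)
    moreover obtain y where "y \<in> insert a I" "c y \<noteq> 0"
      using c(1) by blast
    moreover have "f y = c y" "y \<in> V" if "y \<in> insert a I" for y
      using that V by (auto simp: f_def)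
    ultimately show False by metis
  qed
  moreover have "laplacian V \<rho> (\<lambda>x. f x / f a) x = laplacian V \<rho> f x / f a" for x
    by (simp add: laplacian_def sum_divide_distrib diff_divide_distrib[symmetric])
  ultimately have "dirichlet_solution V \<rho> a B (\<lambda>x. f x / f a)"
    using f by (auto simp: dirichlet_solution_def I_def f_def)
  then show ?thesis by blast
qed

text \<open>
  The Green identity behind all that follows.  The function \<open>g\<close> is free away from \<open>B\<close>; it is taken to
  be the conjugate of the solution, the conjugate of a difference of two solutions, or the solution
  at another frequency.
\<close>

lemma admittance_eq_dirichlet_form:
  assumes v: "dirichlet_solution V \<rho> a B v" and g: "\<And>x. x \<in> B \<Longrightarrow> g x = 0"
  shows "dirichlet_form V \<rho> v g = (\<Sum>x\<in>V. (1 - v x) * \<rho> x a) * g a"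
proof -
  have "(\<Sum>x\<in>V. (1 - v x) * \<rho> x a) = - laplacian V \<rho> v a"
    using v by (simp add: laplacian_def dirichlet_solution_def sym[of a] left_diff_distrib sum_subtractf)
  then show ?thesis
    using dirichlet_form_harmonic[of v g] v g by (simp add: dirichlet_solution_def)
qed

text \<open>
  The current through \<open>a\<close> is estimated by the dissipation, and the dissipation by the modulus of the
  effective admittance \<open>P\<close>, which is that current.  Weighting with \<open>\<bar>Im \<rho>\<bar>\<close> leaves at most half of
  \<open>\<bar>P\<bar>\<close> on the right-hand side, which can be absorbed.
\<close>

lemma admittance_bound:
  assumes v: "dirichlet_solution V \<rho> a B v"
  shows "cmod (\<Sum>x\<in>V. (1 - v x) * \<rho> x a)
    \<le> (\<Sum>x | x \<in> V \<and> {x, a} \<in> E. (cmod (\<rho> x a))\<^sup>2 / \<bar>Im (\<rho> x a)\<bar>)"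
proof -
  define P where "P = (\<Sum>x\<in>V. (1 - v x) * \<rho> x a)"
  define K where "K = (\<Sum>x | x \<in> V \<and> {x, a} \<in> E. (cmod (\<rho> x a))\<^sup>2 / \<bar>Im (\<rho> x a)\<bar>)"
  have va: "v a = 1" and vB: "\<And>x. x \<in> B \<Longrightarrow> v x = 0"
    using v by (auto simp: dirichlet_solution_def)
  have "dirichlet_form V \<rho> v (\<lambda>x. cnj (v x)) = P"
    using admittance_eq_dirichlet_form[OF v, of "\<lambda>x. cnj (v x)"] va vB by (simp add: P_def)
  then have diss: "dissipation V \<rho> v \<le> cmod P"
    using dissipation_le_form[of s \<rho> V v] abs_s one_signed by simp
  have K: "K = (\<Sum>x\<in>V. (cmod (\<rho> x a))\<^sup>2 / \<bar>Im (\<rho> x a)\<bar>)"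
    unfolding K_def by (rule sum.mono_neutral_left) (use finite_V off_edge in auto)
  have "cmod P \<le> (\<Sum>x\<in>V. cmod (v x - v a) * cmod (\<rho> x a))"
    unfolding P_def va by (rule sum_norm_le) (simp add: norm_mult norm_minus_commute)
  also have "\<dots> \<le> (\<Sum>x\<in>V. ((cmod (v x - v a))\<^sup>2 * \<bar>Im (\<rho> x a)\<bar> + (cmod (\<rho> x a))\<^sup>2 / \<bar>Im (\<rho> x a)\<bar>) / 2)"
  proof (rule sum_mono)
    fix x
    show "cmod (v x - v a) * cmod (\<rho> x a)
      \<le> ((cmod (v x - v a))\<^sup>2 * \<bar>Im (\<rho> x a)\<bar> + (cmod (\<rho> x a))\<^sup>2 / \<bar>Im (\<rho> x a)\<bar>) / 2"
      using weighted_am_gm[of "\<bar>Im (\<rho> x a)\<bar>"] strict[of x a] off_edge[of x a]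
      by (cases "{x, a} \<in> E") auto
  qed
  also have "\<dots> = ((\<Sum>x\<in>V. (cmod (v x - v a))\<^sup>2 * \<bar>Im (\<rho> x a)\<bar>) + K) / 2"
    by (simp add: K sum.distrib sum_divide_distrib[symmetric])
  also have "\<dots> \<le> (cmod P + K) / 2"
    using dissipation_at_vertex[OF a_in_V, of v] diss by simp
  finally show ?thesis by (simp add: P_def K_def)
qed

text \<open>
  Let \<open>u = v - v'\<close>.  As \<open>u\<close> vanishes on \<open>B \<union> {a}\<close>, the form of \<open>v\<close> with weights \<open>\<rho>\<close> and the form of
  \<open>v'\<close> with weights \<open>\<rho>'\<close> both vanish against \<open>cnj u\<close>.  So the form of \<open>u\<close> with weights \<open>\<rho>\<close> equals that
  of \<open>v'\<close> with the small weights \<open>\<rho>' - \<rho>\<close>, and absorbing half of the dissipation leaves a bound by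
  data of \<open>v'\<close> alone.  Pairs that are not edges contribute zero to the sum.
\<close>

lemma dissipation_perturbation:
  assumes \<rho>': "dissipative_network V E R L D a B \<rho>' s'"
    and v: "dirichlet_solution V \<rho> a B v" and v': "dirichlet_solution V \<rho>' a B v'"
  shows "dissipation V \<rho> (\<lambda>x. v x - v' x)
    \<le> (\<Sum>x\<in>V. \<Sum>y\<in>V. (cmod (v' x - v' y))\<^sup>2 * (cmod (\<rho>' x y - \<rho> x y))\<^sup>2 / \<bar>Im (\<rho> x y)\<bar>) / 2"
proof -
  interpret N': dissipative_network V E R L D a B \<rho>' s' by (fact \<rho>')
  define u where "u x = v x - v' x" for x
  define W where "W = (\<Sum>x\<in>V. \<Sum>y\<in>V. (cmod (v' x - v' y))\<^sup>2 * (cmod (\<rho>' x y - \<rho> x y))\<^sup>2 / \<bar>Im (\<rho> x y)\<bar>)"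
  have u0: "cnj (u x) = 0" if "x \<in> B \<union> {a}" for x
    using v v' that by (auto simp: u_def dirichlet_solution_def)
  have "dirichlet_form V \<rho> v (\<lambda>x. cnj (u x)) = 0" "dirichlet_form V \<rho>' v' (\<lambda>x. cnj (u x)) = 0"
    using admittance_eq_dirichlet_form[OF v, of "\<lambda>x. cnj (u x)"]
      N'.admittance_eq_dirichlet_form[OF v', of "\<lambda>x. cnj (u x)"] u0 by auto
  then have "dirichlet_form V \<rho> u (\<lambda>x. cnj (u x))
      = dirichlet_form V (\<lambda>x y. \<rho>' x y - \<rho> x y) v' (\<lambda>x. cnj (u x))"
    using dirichlet_form_diff_left[of V \<rho> v v' "\<lambda>x. cnj (u x)"]
    by (simp add: u_def[abs_def] dirichlet_form_diff_weight)
  then have "dissipation V \<rho> u \<le> cmod (dirichlet_form V (\<lambda>x y. \<rho>' x y - \<rho> x y) v' (\<lambda>x. cnj (u x)))"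
    using dissipation_le_form[of s \<rho> V u] abs_s one_signed by simp
  also have "\<dots> = cmod (\<Sum>x\<in>V. \<Sum>y\<in>V. (v' x - v' y) * cnj (u x - u y) * (\<rho>' x y - \<rho> x y)) / 2"
    by (simp add: dirichlet_form_def norm_divide)
  also have "\<dots> \<le> (\<Sum>x\<in>V. \<Sum>y\<in>V. ((cmod (u x - u y))\<^sup>2 * \<bar>Im (\<rho> x y)\<bar> +
      (cmod (v' x - v' y))\<^sup>2 * (cmod (\<rho>' x y - \<rho> x y))\<^sup>2 / \<bar>Im (\<rho> x y)\<bar>) / 2) / 2"
  proof (intro divide_right_mono sum_norm_le)
    fix x y
    let ?r = "cmod (v' x - v' y) * cmod (\<rho>' x y - \<rho> x y)"
    have "cmod (u x - u y) * ?r \<le> ((cmod (u x - u y))\<^sup>2 * \<bar>Im (\<rho> x y)\<bar> + ?r\<^sup>2 / \<bar>Im (\<rho> x y)\<bar>) / 2"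
      using weighted_am_gm[of "\<bar>Im (\<rho> x y)\<bar>"] strict[of x y] off_edge[of x y] N'.off_edge[of x y]
      by (cases "{x, y} \<in> E") auto
    then show "cmod ((v' x - v' y) * cnj (u x - u y) * (\<rho>' x y - \<rho> x y))
      \<le> ((cmod (u x - u y))\<^sup>2 * \<bar>Im (\<rho> x y)\<bar> +
      (cmod (v' x - v' y))\<^sup>2 * (cmod (\<rho>' x y - \<rho> x y))\<^sup>2 / \<bar>Im (\<rho> x y)\<bar>) / 2"
      by (simp only: norm_mult complex_mod_cnj power_mult_distrib mult_ac)
  qed simp
  also have "\<dots> = (dissipation V \<rho> u + W / 2) / 2"
    by (simp only: W_def dissipation_def add_divide_distrib sum.distrib sum_divide_distrib)
  finally show ?thesis
    by (simp add: W_def u_def[abs_def])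
qed

text \<open>
  Both solutions are admissible test functions with value \<open>1\<close> at \<open>a\<close>, so each admittance is the
  symmetric form of \<open>v\<close> and \<open>v'\<close> with its own weights.
\<close>

lemma admittance_difference:
  assumes \<rho>': "dissipative_network V E R L D a B \<rho>' s'"
    and v: "dirichlet_solution V \<rho> a B v" and v': "dirichlet_solution V \<rho>' a B v'"
  shows "(\<Sum>x\<in>V. (1 - v x) * \<rho> x a) - (\<Sum>x\<in>V. (1 - v' x) * \<rho>' x a)
    = dirichlet_form V (\<lambda>x y. \<rho> x y - \<rho>' x y) v v'"
proof -
  interpret N': dissipative_network V E R L D a B \<rho>' s' by (fact \<rho>')
  show ?thesis
    using admittance_eq_dirichlet_form[OF v, of v'] N'.admittance_eq_dirichlet_form[OF v', of v] v v'
    by (simp add: dirichlet_form_diff_weight dirichlet_form_commute[of V \<rho>' v v'] dirichlet_solution_def)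
qed

end

section \<open>Holomorphic dependence\<close>

text \<open>
  The formula \<open>admittance_difference\<close> already exhibits the factor \<open>\<rho> \<nu> - \<rho> \<mu>\<close>, so only the continuity
  of the differences of the solution along edges is needed to pass to the limit in the difference
  quotient.
\<close>

lemma admittance_has_field_derivative:
  fixes \<rho> :: "complex \<Rightarrow> 'v \<Rightarrow> 'v \<Rightarrow> complex"
  assumes \<Omega>: "open \<Omega>" "\<mu> \<in> \<Omega>"
    and net: "\<And>\<nu>. \<nu> \<in> \<Omega> \<Longrightarrow> dissipative_network V E R L D a B (\<rho> \<nu>) (s \<nu>)"
    and v: "\<And>\<nu>. \<nu> \<in> \<Omega> \<Longrightarrow> dirichlet_solution V (\<rho> \<nu>) a B (v \<nu>)"
    and deriv: "\<And>x y. ((\<lambda>\<nu>. \<rho> \<nu> x y) has_field_derivative \<rho>' x y) (at \<mu>)"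
  shows "((\<lambda>\<nu>. \<Sum>x\<in>V. (1 - v \<nu> x) * \<rho> \<nu> x a) has_field_derivative
    dirichlet_form V \<rho>' (v \<mu>) (v \<mu>)) (at \<mu>)"
proof -
  interpret N: dissipative_network V E R L D a B "\<rho> \<mu>" "s \<mu>"
    using net \<Omega> by blast
  have near: "eventually (\<lambda>\<nu>. \<nu> \<in> \<Omega>) (at \<mu>)"
    using \<Omega> eventually_at_topological by blast
  have cont: "((\<lambda>\<nu>. \<rho> \<nu> x y) \<longlongrightarrow> \<rho> \<mu> x y) (at \<mu>)" for x y
    using deriv[THEN DERIV_isCont] by (simp add: isCont_def)
  \<comment> \<open>Twice the bound from \<open>dissipation_perturbation\<close>, with the solution at \<open>\<mu>\<close> as the reference.\<close>
  define W where "W \<nu> = (\<Sum>x\<in>V. \<Sum>y\<in>V. (cmod (v \<mu> x - v \<mu> y))\<^sup>2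
      * (cmod (\<rho> \<mu> x y - \<rho> \<nu> x y))\<^sup>2 / \<bar>Im (\<rho> \<nu> x y)\<bar>)" for \<nu>
  have "((\<lambda>\<nu>. (cmod (v \<mu> x - v \<mu> y))\<^sup>2 * (cmod (\<rho> \<mu> x y - \<rho> \<nu> x y))\<^sup>2 / \<bar>Im (\<rho> \<nu> x y)\<bar>) \<longlongrightarrow> 0) (at \<mu>)" for x y
  proof (cases "{x, y} \<in> E")
    case True
    have "((\<lambda>\<nu>. (cmod (v \<mu> x - v \<mu> y))\<^sup>2 * (cmod (\<rho> \<mu> x y - \<rho> \<nu> x y))\<^sup>2 / \<bar>Im (\<rho> \<nu> x y)\<bar>)
        \<longlongrightarrow> (cmod (v \<mu> x - v \<mu> y))\<^sup>2 * (cmod (\<rho> \<mu> x y - \<rho> \<mu> x y))\<^sup>2 / \<bar>Im (\<rho> \<mu> x y)\<bar>) (at \<mu>)"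
      by (intro tendsto_intros cont) (use N.strict[OF True] in simp)
    then show ?thesis by simp
  next
    case False
    have "eventually (\<lambda>\<nu>. (cmod (v \<mu> x - v \<mu> y))\<^sup>2 * (cmod (\<rho> \<mu> x y - \<rho> \<nu> x y))\<^sup>2 / \<bar>Im (\<rho> \<nu> x y)\<bar> = 0) (at \<mu>)"
      using near by eventually_elim (use False dissipative_network.off_edge[OF net] in simp)
    then show ?thesis by (rule tendsto_eventually)
  qed
  then have "(W \<longlongrightarrow> (\<Sum>x\<in>V. \<Sum>y\<in>V. 0)) (at \<mu>)"
    unfolding W_def[abs_def] by (intro tendsto_sum)
  then have W0: "(W \<longlongrightarrow> 0) (at \<mu>)" by simp
  have grad: "((\<lambda>\<nu>. v \<nu> x - v \<nu> y) \<longlongrightarrow> v \<mu> x - v \<mu> y) (at \<mu>)" if xy: "{x, y} \<in> E" for x y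
  proof -
    define u where "u \<nu> x = v \<nu> x - v \<mu> x" for \<nu> x
    have "((\<lambda>\<nu>. sqrt (W \<nu> / \<bar>Im (\<rho> \<nu> x y)\<bar>)) \<longlongrightarrow> sqrt (0 / \<bar>Im (\<rho> \<mu> x y)\<bar>)) (at \<mu>)"
      by (intro tendsto_intros cont W0) (use N.strict[OF xy] in simp)
    then have lim: "((\<lambda>\<nu>. sqrt (W \<nu> / \<bar>Im (\<rho> \<nu> x y)\<bar>)) \<longlongrightarrow> 0) (at \<mu>)"
      by simp
    have "eventually (\<lambda>\<nu>. cmod (u \<nu> x - u \<nu> y) \<le> sqrt (W \<nu> / \<bar>Im (\<rho> \<nu> x y)\<bar>)) (at \<mu>)"
      using near
    proof eventually_elim
      case (elim \<nu>)
      interpret N': dissipative_network V E R L D a B "\<rho> \<nu>" "s \<nu>"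
        using net elim by blast
      have "(cmod (u \<nu> x - u \<nu> y))\<^sup>2 * \<bar>Im (\<rho> \<nu> x y)\<bar> \<le> 2 * dissipation V (\<rho> \<nu>) (u \<nu>)"
        using N'.dissipation_edge N.edge_in_V[OF xy] by blast
      also have "\<dots> \<le> W \<nu>"
        using N'.dissipation_perturbation[OF net[OF \<Omega>(2)] v[OF elim] v[OF \<Omega>(2)]]
        by (simp add: u_def[abs_def] W_def)
      finally have "(cmod (u \<nu> x - u \<nu> y))\<^sup>2 \<le> W \<nu> / \<bar>Im (\<rho> \<nu> x y)\<bar>"
        using N'.strict[OF xy] by (simp add: pos_le_divide_eq)
      then show ?case by (rule real_le_rsqrt)
    qed
    then have "((\<lambda>\<nu>. u \<nu> x - u \<nu> y) \<longlongrightarrow> 0) (at \<mu>)"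
      by (rule Lim_null_comparison) (rule lim)
    then have "((\<lambda>\<nu>. (u \<nu> x - u \<nu> y) + (v \<mu> x - v \<mu> y)) \<longlongrightarrow> 0 + (v \<mu> x - v \<mu> y)) (at \<mu>)"
      by (intro tendsto_intros)
    then show ?thesis by (simp add: u_def)
  qed
  have "((\<lambda>\<nu>. (v \<nu> x - v \<nu> y) * (v \<mu> x - v \<mu> y) * ((\<rho> \<nu> x y - \<rho> \<mu> x y) / (\<nu> - \<mu>)))
      \<longlongrightarrow> (v \<mu> x - v \<mu> y) * (v \<mu> x - v \<mu> y) * \<rho>' x y) (at \<mu>)" (is "(?q \<longlongrightarrow> _) _") for x y
  proof -
    have quot: "((\<lambda>\<nu>. (\<rho> \<nu> x y - \<rho> \<mu> x y) / (\<nu> - \<mu>)) \<longlongrightarrow> \<rho>' x y) (at \<mu>)"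
      using deriv[of x y] by (simp add: has_field_derivative_iff)
    show ?thesis
    proof (cases "{x, y} \<in> E")
      case True
      show ?thesis by (intro tendsto_intros grad[OF True] quot)
    next
      case False
      have ev: "eventually (\<lambda>\<nu>. \<rho> \<nu> x y - \<rho> \<mu> x y = 0) (at \<mu>)"
        using near by eventually_elim (use False dissipative_network.off_edge[OF net] \<Omega> in simp)
      then have "((\<lambda>\<nu>. (\<rho> \<nu> x y - \<rho> \<mu> x y) / (\<nu> - \<mu>)) \<longlongrightarrow> 0) (at \<mu>)"
        by (intro tendsto_eventually) (auto elim: eventually_mono)
      then have "\<rho>' x y = 0"
        using quot tendsto_unique[of "at \<mu>"] by force
      moreover have "(?q \<longlongrightarrow> 0) (at \<mu>)"
        using ev by (intro tendsto_eventually) (auto elim: eventually_mono)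
      ultimately show ?thesis by simp
    qed
  qed
  then have lim: "((\<lambda>\<nu>. (\<Sum>x\<in>V. \<Sum>y\<in>V. (v \<nu> x - v \<nu> y) * (v \<mu> x - v \<mu> y)
      * ((\<rho> \<nu> x y - \<rho> \<mu> x y) / (\<nu> - \<mu>))) / 2) \<longlongrightarrow> dirichlet_form V \<rho>' (v \<mu>) (v \<mu>)) (at \<mu>)"
    unfolding dirichlet_form_def by (intro tendsto_divide tendsto_sum tendsto_const) simp_all
  have eq: "eventually (\<lambda>\<nu>. (\<Sum>x\<in>V. \<Sum>y\<in>V. (v \<nu> x - v \<nu> y) * (v \<mu> x - v \<mu> y)
      * ((\<rho> \<nu> x y - \<rho> \<mu> x y) / (\<nu> - \<mu>))) / 2
      = ((\<Sum>x\<in>V. (1 - v \<nu> x) * \<rho> \<nu> x a) - (\<Sum>x\<in>V. (1 - v \<mu> x) * \<rho> \<mu> x a)) / (\<nu> - \<mu>)) (at \<mu>)"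
    using near
  proof eventually_elim
    case (elim \<nu>)
    interpret N': dissipative_network V E R L D a B "\<rho> \<nu>" "s \<nu>"
      using net elim by blast
    show ?case
      unfolding N'.admittance_difference[OF net[OF \<Omega>(2)] v[OF elim] v[OF \<Omega>(2)]]
      by (simp add: dirichlet_form_def sum_divide_distrib mult_ac)
  qed
  show ?thesis
    unfolding has_field_derivative_iff using Lim_transform_eventually[OF lim eq] .
qed

section \<open>Impedances off the real axis\<close>

lemma Im_impedance:
  "Im (impedance R L D \<mu> e) = Im \<mu> * (L e - D e / (cmod \<mu>)\<^sup>2)"
  by (simp add: impedance_def Im_divide cmod_power2 right_diff_distrib mult.commute)

text \<open>
  For \<open>\<bar>\<mu>\<bar>\<^sup>2 > S\<close> the inductive term outweighs the capacitive one: \<open>D e \<le> S * L e\<close> leaves at least the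
  fraction \<open>1 - S / \<bar>\<mu>\<bar>\<^sup>2\<close> of \<open>L e\<close>.
\<close>

lemma abs_Im_impedance_ge:
  assumes "L e > 0" "D e / L e \<le> S" "S < (cmod \<mu>)\<^sup>2" "\<mu> \<noteq> 0"
  shows "L e - D e / (cmod \<mu>)\<^sup>2 > 0"
    and "\<bar>Im (impedance R L D \<mu> e)\<bar> \<ge> L e * (\<bar>Im \<mu>\<bar> * ((cmod \<mu>)\<^sup>2 - S) / (cmod \<mu>)\<^sup>2)"
proof -
  have D: "D e \<le> S * L e"
    using assms by (simp add: pos_divide_le_eq)
  have m: "(cmod \<mu>)\<^sup>2 > 0"
    using assms by simp
  have *: "L e - D e / (cmod \<mu>)\<^sup>2 \<ge> L e * (((cmod \<mu>)\<^sup>2 - S) / (cmod \<mu>)\<^sup>2)"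
    using D m by (simp add: field_simps)
  moreover have "L e * (((cmod \<mu>)\<^sup>2 - S) / (cmod \<mu>)\<^sup>2) > 0"
    using assms m by simp
  ultimately show pos: "L e - D e / (cmod \<mu>)\<^sup>2 > 0"
    by linarith
  have "\<bar>Im \<mu>\<bar> * (L e * (((cmod \<mu>)\<^sup>2 - S) / (cmod \<mu>)\<^sup>2)) \<le> \<bar>Im \<mu>\<bar> * (L e - D e / (cmod \<mu>)\<^sup>2)"
    using * by (rule mult_left_mono) simp
  then show "\<bar>Im (impedance R L D \<mu> e)\<bar> \<ge> L e * (\<bar>Im \<mu>\<bar> * ((cmod \<mu>)\<^sup>2 - S) / (cmod \<mu>)\<^sup>2)"
    using pos by (simp add: Im_impedance abs_mult mult_ac)
qed

lemma admittance_deriv_exists: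
  assumes "\<mu> \<noteq> 0" "{x, y} \<in> E \<Longrightarrow> impedance R L D \<mu> {x, y} \<noteq> 0"
  shows "\<exists>d. ((\<lambda>\<nu>. admittance E R L D \<nu> x y) has_field_derivative d) (at \<mu>)"
proof (cases "{x, y} \<in> E")
  case True
  have "(\<lambda>\<nu>. 1 / impedance R L D \<nu> {x, y}) field_differentiable at \<mu>"
    unfolding impedance_def
    by (intro derivative_intros) (use assms True in \<open>auto simp: impedance_def\<close>)
  then show ?thesis
    using True by (simp add: admittance_def field_differentiable_def)
next
  case False
  then show ?thesis
    by (auto simp: admittance_def intro: exI[of _ 0])
qed

lemma Im_inverse_complex: "Im (1 / z) = - Im z / (cmod z)\<^sup>2"
  by (simp add: Im_divide cmod_power2)

theorem theorem16:
  fixes V :: "'v set" and E :: "'v set set"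
    and R L D :: "'v set \<Rightarrow> real"
    and a :: 'v and B :: "'v set"
    and S_D S_R C' :: real
    and \<Omega> :: "complex set"
  assumes network: "finite_network V E R L D a B"
    and L_pos: "\<And>e. e \<in> E \<Longrightarrow> L e > 0"
    and S_D: "S_D = (SUP e\<in>E. D e / L e)"
    and S_R: "S_R = (SUP e\<in>E. R e / L e)"
    and C': "C' = (\<Sum>x | x \<in> V \<and> {x, a} \<in> E. 1 / L {x, a})"
    and \<Omega>: "\<Omega> = {\<mu>. Im \<mu> \<noteq> 0 \<and> (cmod \<mu>)\<^sup>2 > S_D}"
  shows "\<Omega> \<subseteq> admissible E R L D
    \<and> (\<forall>\<mu>\<in>\<Omega>. effective_admittance V E R L D a B \<mu> \<noteq> None)
    \<and> (\<lambda>\<mu>. the (effective_admittance V E R L D a B \<mu>)) holomorphic_on \<Omega>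
    \<and> (\<forall>\<mu>\<in>\<Omega>. cmod (the (effective_admittance V E R L D a B \<mu>))
          \<le> C' * (2 * cmod \<mu> + S_R)\<^sup>2 * cmod \<mu> ^ 6
            / (((cmod \<mu>)\<^sup>2 - S_D) ^ 3 * \<bar>Im \<mu>\<bar> ^ 3))"
proof -
  interpret finite_network V E R L D a B by (fact network)
  have "E \<subseteq> (\<lambda>(x, y). {x, y}) ` (V \<times> V)"
    using edges by auto
  then have finE: "finite E"
    by (rule finite_subset) (use finite_V in auto)
  have "E \<noteq> {}"
  proof
    assume "E = {}"
    moreover obtain b where b: "b \<in> B" "b \<in> V" "b \<noteq> a"
      using B_nonempty B_subset_V a_notin_B by blast
    ultimately show False
      using connected_graph[OF a_in_V b(2)] by auto
  qed
  then obtain e\<^sub>0 where e0: "e\<^sub>0 \<in> E" by blast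
  have DL: "D e / L e \<le> S_D" and RL: "R e / L e \<le> S_R" if "e \<in> E" for e
    unfolding S_D S_R using that finE by (auto intro!: cSUP_upper)
  have "0 \<le> D e\<^sub>0 / L e\<^sub>0" "0 \<le> R e\<^sub>0 / L e\<^sub>0"
    using D_nonneg R_nonneg L_nonneg e0 by auto
  then have S0: "S_D \<ge> 0" "S_R \<ge> 0"
    using DL[OF e0] RL[OF e0] by linarith+
  have z0: "\<mu> \<noteq> 0" if "\<mu> \<in> \<Omega>" for \<mu>
    using that \<Omega> by auto
  have pos: "L e - D e / (cmod \<mu>)\<^sup>2 > 0" if "e \<in> E" "\<mu> \<in> \<Omega>" for e \<mu>
    using abs_Im_impedance_ge(1)[of L e D S_D \<mu>] L_pos DL z0 that \<Omega> by simp
  have Im_z: "Im (impedance R L D \<mu> e) \<noteq> 0" if "e \<in> E" "\<mu> \<in> \<Omega>" for e \<mu>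
    using pos[OF that] that(2) \<Omega> by (simp add: Im_impedance)
  then have z_nz: "impedance R L D \<mu> e \<noteq> 0" if "e \<in> E" "\<mu> \<in> \<Omega>" for e \<mu>
    using that by force
  define \<rho> where "\<rho> = admittance E R L D"
  have net: "dissipative_network V E R L D a B (\<rho> \<mu>) (- sgn (Im \<mu>))" if \<mu>: "\<mu> \<in> \<Omega>" for \<mu>
  proof
    show "\<rho> \<mu> x y = \<rho> \<mu> y x" for x y
      unfolding \<rho>_def by (rule admittance_sym)
    show "\<rho> \<mu> x y = 0" if "{x, y} \<notin> E" for x y
      using that by (simp add: \<rho>_def admittance_def)
    show "\<bar>- sgn (Im \<mu>)\<bar> = 1"
      using \<mu> \<Omega> by (simp add: abs_sgn_eq)
    show "Im (\<rho> \<mu> x y) \<noteq> 0" if "{x, y} \<in> E" for x y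
      using that Im_z[OF that \<mu>] z_nz[OF that \<mu>]
      by (simp add: \<rho>_def admittance_def Im_inverse_complex)
    show "\<bar>Im (\<rho> \<mu> x y)\<bar> = - sgn (Im \<mu>) * Im (\<rho> \<mu> x y)" for x y
    proof (cases "{x, y} \<in> E")
      case True
      show ?thesis
        using True pos[OF True \<mu>]
        by (simp add: \<rho>_def admittance_def Im_inverse_complex Im_impedance abs_mult abs_sgn[of "Im \<mu>"] mult_ac)
    qed (simp add: \<rho>_def admittance_def)
  qed
  \<comment> \<open>A solution is chosen at each frequency; any choice yields the same admittance.\<close>
  obtain v where v: "\<And>\<mu>. \<mu> \<in> \<Omega> \<Longrightarrow> dirichlet_solution V (\<rho> \<mu>) a B (v \<mu>)"
    using dissipative_network.dirichlet_solution_exists[OF net] by metis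
  have eff: "effective_admittance V E R L D a B \<mu> = Some (\<Sum>x\<in>V. (1 - v \<mu> x) * \<rho> \<mu> x a)"
    if "\<mu> \<in> \<Omega>" for \<mu>
    using effective_admittance_eq v[OF that] by (simp add: \<rho>_def)

  have "\<Omega> \<subseteq> admissible E R L D"
  proof
    fix \<mu> assume \<mu>: "\<mu> \<in> \<Omega>"
    have "complex_of_real (L e) * \<mu>\<^sup>2 + complex_of_real (R e) * \<mu> + complex_of_real (D e)
        = \<mu> * impedance R L D \<mu> e" for e
      using z0[OF \<mu>] by (simp add: impedance_def power2_eq_square algebra_simps)
    then show "\<mu> \<in> admissible E R L D"
      using z0[OF \<mu>] z_nz[OF _ \<mu>] by (simp add: admissible_def)
  qed
  moreover have "(\<lambda>\<mu>. the (effective_admittance V E R L D a B \<mu>)) holomorphic_on \<Omega>"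
  proof -
    have "open \<Omega>"
      unfolding \<Omega> by (intro open_Collect_conj open_Collect_neq open_Collect_less continuous_intros)
    moreover have "(\<lambda>\<mu>. \<Sum>x\<in>V. (1 - v \<mu> x) * \<rho> \<mu> x a) field_differentiable at \<mu>" if \<mu>: "\<mu> \<in> \<Omega>" for \<mu>
    proof -
      have "\<exists>d. ((\<lambda>\<nu>. \<rho> \<nu> x y) has_field_derivative d) (at \<mu>)" for x y
        unfolding \<rho>_def using admittance_deriv_exists z0[OF \<mu>] z_nz[OF _ \<mu>] by metis
      then obtain \<rho>' where "\<And>x y. ((\<lambda>\<nu>. \<rho> \<nu> x y) has_field_derivative \<rho>' x y) (at \<mu>)"
        by metis
      from admittance_has_field_derivative[OF \<open>open \<Omega>\<close> \<mu> net v this] show ?thesis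
        by (auto simp: field_differentiable_def)
    qed
    ultimately have "(\<lambda>\<mu>. \<Sum>x\<in>V. (1 - v \<mu> x) * \<rho> \<mu> x a) holomorphic_on \<Omega>"
      by (simp add: holomorphic_on_open field_differentiable_def)
    then show ?thesis
      by (rule holomorphic_transform) (simp add: eff)
  qed
  moreover have "cmod (the (effective_admittance V E R L D a B \<mu>))
          \<le> C' * (2 * cmod \<mu> + S_R)\<^sup>2 * cmod \<mu> ^ 6
            / (((cmod \<mu>)\<^sup>2 - S_D) ^ 3 * \<bar>Im \<mu>\<bar> ^ 3)" if \<mu>: "\<mu> \<in> \<Omega>" for \<mu>
  proof -
    define m where "m = cmod \<mu>"
    define d where "d = m\<^sup>2 - S_D"
    define i where "i = \<bar>Im \<mu>\<bar>"
    have d: "0 < d" "d \<le> m\<^sup>2" and i: "0 < i" "i \<le> m" and m: "m > 0"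
      using \<mu> \<Omega> S0 abs_Im_le_cmod[of \<mu>] z0[OF \<mu>] by (auto simp: d_def i_def m_def)
    have C0: "C' \<ge> 0"
      unfolding C' using L_nonneg by (auto intro: sum_nonneg)
    interpret N: dissipative_network V E R L D a B "\<rho> \<mu>" "- sgn (Im \<mu>)"
      by (rule net[OF \<mu>])
    have "cmod (the (effective_admittance V E R L D a B \<mu>))
        \<le> (\<Sum>x | x \<in> V \<and> {x, a} \<in> E. (cmod (\<rho> \<mu> x a))\<^sup>2 / \<bar>Im (\<rho> \<mu> x a)\<bar>)"
      using N.admittance_bound[OF v[OF \<mu>]] by (simp add: eff[OF \<mu>])
    also have "\<dots> \<le> (\<Sum>x | x \<in> V \<and> {x, a} \<in> E. 1 / L {x, a} * (m\<^sup>2 / (i * d)))"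
    proof (rule sum_mono)
      fix x assume "x \<in> {x \<in> V. {x, a} \<in> E}"
      then have e: "{x, a} \<in> E" by simp
      let ?z = "impedance R L D \<mu> {x, a}"
      have "(cmod (\<rho> \<mu> x a))\<^sup>2 / \<bar>Im (\<rho> \<mu> x a)\<bar> = 1 / \<bar>Im ?z\<bar>"
        using e z_nz[OF e \<mu>]
        by (simp add: \<rho>_def admittance_def Im_inverse_complex norm_divide power_divide)
      also have "\<dots> \<le> 1 / (L {x, a} * (i * d / m\<^sup>2))"
      proof (rule frac_le)
        show "L {x, a} * (i * d / m\<^sup>2) \<le> \<bar>Im ?z\<bar>"
          using abs_Im_impedance_ge(2)[of L "{x, a}" D S_D \<mu> R] L_pos[OF e] DL[OF e] z0[OF \<mu>] d
          by (simp add: m_def d_def i_def)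
        show "0 < L {x, a} * (i * d / m\<^sup>2)"
          using L_pos[OF e] d i m by simp
      qed simp_all
      finally show "(cmod (\<rho> \<mu> x a))\<^sup>2 / \<bar>Im (\<rho> \<mu> x a)\<bar> \<le> 1 / L {x, a} * (m\<^sup>2 / (i * d))"
        by simp
    qed
    also have "\<dots> = C' * (m\<^sup>2 / (i * d))"
      unfolding C' by (rule sum_distrib_right[symmetric])
    also have "\<dots> \<le> C' * ((2 * m + S_R)\<^sup>2 * m ^ 6 / (d ^ 3 * i ^ 3))"
    proof (rule mult_left_mono[OF _ C0])
      \<comment> \<open>The claimed bound is \<open>m\<^sup>2 / (i * d)\<close> times the right-hand side over the left-hand side.\<close>
      have "i\<^sup>2 * d\<^sup>2 \<le> (2 * m + S_R)\<^sup>2 * (m\<^sup>2)\<^sup>2"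
        using d i m S0 by (intro mult_mono power_mono) auto
      then have "m\<^sup>2 / (i * d) * (i\<^sup>2 * d\<^sup>2) \<le> m\<^sup>2 / (i * d) * ((2 * m + S_R)\<^sup>2 * (m\<^sup>2)\<^sup>2)"
        using d i by (intro mult_left_mono) auto
      then show "m\<^sup>2 / (i * d) \<le> (2 * m + S_R)\<^sup>2 * m ^ 6 / (d ^ 3 * i ^ 3)"
        using d i by (simp add: field_simps power2_eq_square power3_eq_cube eval_nat_numeral)
    qed
    finally show ?thesis
      by (simp add: m_def d_def i_def mult.assoc)
  qed
  ultimately show ?thesis
    using eff by simp
qed

end
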